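(* Let $(\Omega,\Sigma)$ be a standard Borel space. Let $f_k:[0,1]\to\mathbb{R}$, $k\in\mathbb{N}$, be a sequence of Lipschitz functions with $f_k(0)=0$, and let $(\lambda_k)_k$ be a sequence of nonatomic countably additive probability measures on $\Sigma$. Assume that (1) $\lim_{x\to0^+}\frac{f_k(x)}{x}=f_k'(0)$ uniformly with respect to $k$; (2) $(\lambda_k)_k$ converges setwise to some nonatomic countably additive probability measure $\mu$ on $\Sigma$. Then the sequence of games $\nu_k=f_k\circ\lambda_k$ is uniformly BC integrable.
   Context: A game is a set function $\nu:\Sigma\to\mathbb{R}$ with $\nu(\emptyset)=0$. $NA^+$ is the set of nonnegative (finite) nonatomic countably additive measures on $\Sigma$. Here $f_k'(0)$ is the (finite) right-hand derivative of $f_k$ at $0$. For $E\in\Sigma$, $\Pi(E)$ is the set of finite partitions of $E$ into disjoint elements of $\Sigma$. For $\lambda\in NA^+$ and $D\in\Pi(E)$ put $\delta_\lambda(D)=\max\{\lambda(I):I\in D\}$. A game $\nu$ is $\delta_\lambda$-BC (Burkill-Cesari) integrable if for every $E\in\Sigma$ the finite limit $\partial^+_{\emptyset}(\nu,E):=\lim_{\delta_\lambda(D)\to0,\,D\in\Pi(E)}\sum_{I\in D}\nu(I)$ exists, i.e. for every $\varepsilon>0$ there is $\delta>0$ such that $|\sum_{I\in D}\nu(I)-\partial^+_{\emptyset}(\nu,E)|<\varepsilon$ for all $D\in\Pi(E)$ with $\delta_\lambda(D)<\delta$. The integral is known not to depend on the choice of $\lambda\in NA^+$ for which $\nu$ is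 $\delta_\lambda$-BC integrable. Put $\lambda=\sum_{n=1}^\infty\lambda_n/2^n$. The sequence $(\nu_k)_k$, where each $\nu_k$ is $\delta_{\lambda_k}$-BC integrable (hence also $\delta_\lambda$-BC integrable), is uniformly BC integrable if for every $F\in\Sigma$ and every $\varepsilon>0$ there exists $\delta>0$ such that for every $D\in\Pi(F)$ with $\delta_\lambda(D)<\delta$ and every $k\in\mathbb{N}$, $\left|\sum_{I\in D}\nu_k(I)-\partial^+_{\emptyset}(\nu_k,F)\right|<\varepsilon$. *)

theory Defs
  imports "HOL-Probability.Probability"
begin

text \<open>
  A measurable space \<open>(\<Omega>, \<Sigma>)\<close> is represented by a measure \<open>M\<close>, of which only
  \<open>space M\<close> and \<open>sets M\<close> are used. Set functions on \<open>\<Sigma>\<close> have type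
  \<open>'a set \<Rightarrow> real\<close>; their values outside \<open>sets M\<close> are irrelevant.
\<close>

definition standard_borel_space :: "'a measure \<Rightarrow> bool" where
  "standard_borel_space M \<longleftrightarrow>
     (\<exists>X. completely_metrizable_space X \<and> second_countable X \<and>
          topspace X = space M \<and> sets M = sigma_sets (topspace X) {U. openin X U})"

definition nonatomic :: "'a measure \<Rightarrow> bool" where
  "nonatomic L \<longleftrightarrow>
     (\<forall>A\<in>sets L. 0 < emeasure L A \<longrightarrow>
        (\<exists>B\<in>sets L. B \<subseteq> A \<and> 0 < emeasure L B \<and> emeasure L B < emeasure L A))"

definition NA_plus :: "'a measure \<Rightarrow> 'a measure set" where
  "NA_plus M = {L. sets L = sets M \<and> finite_measure L \<and> nonatomic L}"

definition game :: "('a set \<Rightarrow> real) \<Rightarrow> bool" where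
  "game \<nu> \<longleftrightarrow> \<nu> {} = 0"

text \<open>
  The library's partitions have no empty cells. For games this is harmless: an empty cell
  contributes nothing to a sum and does not change the mesh.
\<close>

definition fin_partitions :: "'a measure \<Rightarrow> 'a set \<Rightarrow> 'a set set set" where
  "fin_partitions M E = {D. finite D \<and> D \<subseteq> sets M \<and> partition_on E D}"

text \<open>The inserted \<open>0\<close> only matters for the partition \<open>{}\<close> of the empty set.\<close>

definition mesh :: "'a measure \<Rightarrow> 'a set set \<Rightarrow> real" where
  "mesh L D = Max (insert 0 (measure L ` D))"

definition has_BC_integral ::
    "'a measure \<Rightarrow> 'a measure \<Rightarrow> ('a set \<Rightarrow> real) \<Rightarrow> 'a set \<Rightarrow> real \<Rightarrow> bool" where
  "has_BC_integral M L \<nu> E l \<longleftrightarrow>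
     (\<forall>\<epsilon>>0. \<exists>\<delta>>0. \<forall>D\<in>fin_partitions M E. mesh L D < \<delta> \<longrightarrow> \<bar>(\<Sum>I\<in>D. \<nu> I) - l\<bar> < \<epsilon>)"

definition BC_integrable :: "'a measure \<Rightarrow> 'a measure \<Rightarrow> ('a set \<Rightarrow> real) \<Rightarrow> bool" where
  "BC_integrable M L \<nu> \<longleftrightarrow>
     game \<nu> \<and> L \<in> NA_plus M \<and> (\<forall>E\<in>sets M. \<exists>l. has_BC_integral M L \<nu> E l)"

text \<open>
  The limit is unique for \<open>L \<in> NA_plus M\<close>, since every set then has partitions of
  arbitrarily small mesh.
\<close>

definition BC_integral :: "'a measure \<Rightarrow> 'a measure \<Rightarrow> ('a set \<Rightarrow> real) \<Rightarrow> 'a set \<Rightarrow> real" where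
  "BC_integral M L \<nu> E = (THE l. has_BC_integral M L \<nu> E l)"

text \<open>
  The measure \<open>\<Sum>n\<ge>1. \<lambda>\<^sub>n / 2^n\<close>; sequences are indexed from \<open>0\<close> here, hence the
  exponent \<open>Suc n\<close>.
\<close>

definition mix_measure :: "'a measure \<Rightarrow> (nat \<Rightarrow> 'a measure) \<Rightarrow> 'a measure" where
  "mix_measure M L = measure_of (space M) (sets M) (\<lambda>A. \<Sum>n. emeasure (L n) A / 2 ^ Suc n)"

lemma sets_mix_measure: "sets (mix_measure M L) = sets M"
  by (simp add: mix_measure_def)

lemma emeasure_mix_measure:
  assumes L: "\<And>n. sets (L n) = sets M" and A: "A \<in> sets M"
  shows "emeasure (mix_measure M L) A = (\<Sum>n. emeasure (L n) A / 2 ^ Suc n)"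
proof (rule emeasure_measure_of[OF mix_measure_def], unfold sets_mix_measure)
  show "sets M \<subseteq> Pow (space M)" by (rule sets.space_closed)
  show "A \<in> sets M" by (rule A)
  show "positive (sets M) (\<lambda>A. \<Sum>n. emeasure (L n) A / 2 ^ Suc n)"
    by (simp add: positive_def)
  show "countably_additive (sets M) (\<lambda>A. \<Sum>n. emeasure (L n) A / 2 ^ Suc n)"
  proof (rule countably_additiveI)
    fix B :: "nat \<Rightarrow> 'a set"
    assume B: "range B \<subseteq> sets M" "disjoint_family B"
    have "(\<Sum>i. \<Sum>n. emeasure (L n) (B i) / 2 ^ Suc n) =
          (\<Sum>n. \<Sum>i. emeasure (L n) (B i) / 2 ^ Suc n)"
      using nn_integral_suminf[of "\<lambda>n i. emeasure (L n) (B i) / 2 ^ Suc n" "count_space UNIV"]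
      by (simp add: nn_integral_count_space_nat del: power_Suc)
    also have "\<dots> = (\<Sum>n. emeasure (L n) (\<Union>i. B i) / 2 ^ Suc n)"
    proof (rule suminf_cong)
      fix n
      have "(\<Sum>i. emeasure (L n) (B i)) = emeasure (L n) (\<Union>i. B i)"
        by (rule suminf_emeasure) (use B L in auto)
      then show "(\<Sum>i. emeasure (L n) (B i) / 2 ^ Suc n) = emeasure (L n) (\<Union>i. B i) / 2 ^ Suc n"
        by (simp add: divide_ennreal_def ennreal_suminf_multc)
    qed
    finally show "(\<Sum>i. \<Sum>n. emeasure (L n) (B i) / 2 ^ Suc n) =
                  (\<Sum>n. emeasure (L n) (\<Union>i. B i) / 2 ^ Suc n)" .
  qed
qed

definition uniformly_BC_integrable ::
    "'a measure \<Rightarrow> (nat \<Rightarrow> 'a measure) \<Rightarrow> (nat \<Rightarrow> 'a set \<Rightarrow> real) \<Rightarrow> bool" where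
  "uniformly_BC_integrable M L \<nu> \<longleftrightarrow>
     (\<forall>k. BC_integrable M (L k) (\<nu> k)) \<and>
     (\<forall>F\<in>sets M. \<forall>\<epsilon>>0. \<exists>\<delta>>0. \<forall>D\<in>fin_partitions M F. mesh (mix_measure M L) D < \<delta> \<longrightarrow>
        (\<forall>k. \<bar>(\<Sum>I\<in>D. \<nu> k I) - BC_integral M (L k) (\<nu> k) F\<bar> < \<epsilon>))"

end

theory Submission
  imports Defs
begin

text \<open>
  The integral of \<open>f\<^sub>k \<circ> \<lambda>\<^sub>k\<close> over \<open>F\<close> is \<open>f\<^sub>k'(0) \<lambda>\<^sub>k(F)\<close>: if
  \<open>\<bar>f\<^sub>k(x) - f\<^sub>k'(0) x\<bar> \<le> \<epsilon> x\<close> for \<open>0 \<le> x < \<eta>\<close>, then summing over a partition whose cells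
  have \<open>\<lambda>\<^sub>k\<close>-measure less than \<open>\<eta>\<close> gives an error of at most \<open>\<epsilon> \<lambda>\<^sub>k(F) \<le> \<epsilon>\<close>. By hypothesis
  (1), \<open>\<eta>\<close> does not depend on \<open>k\<close>, and by the Vitali-Hahn-Saks theorem the cells are uniformly
  \<open>\<lambda>\<^sub>k\<close>-small as soon as they are \<open>\<lambda>\<close>-small. For nonnegative measures with a countably additive
  limit, that theorem is a consequence of the Borel-Cantelli lemma.
\<close>

section \<open>Vitali-Hahn-Saks for nonnegative measures\<close>

lemma vitali_hahn_saks_nonneg:
  fixes L :: "nat \<Rightarrow> 'a measure"
  assumes N: "finite_measure N"
    and L: "\<And>k. finite_measure (L k)" "\<And>k. sets (L k) = sets N"
    and ac: "\<And>k. absolutely_continuous N (L k)"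
    and \<mu>: "finite_measure \<mu>" "sets \<mu> = sets N"
    and lim: "\<And>A. A \<in> sets N \<Longrightarrow> (\<lambda>k. measure (L k) A) \<longlonglongrightarrow> measure \<mu> A"
    and "0 < \<eta>"
  shows "\<exists>\<delta>>0. \<forall>A\<in>sets N. measure N A < \<delta> \<longrightarrow> (\<forall>k. measure (L k) A < \<eta>)"
proof (rule ccontr)
  interpret N: finite_measure N by (rule N)
  interpret L: finite_measure "L k" for k by (rule L)
  interpret \<mu>: finite_measure \<mu> by (rule \<mu>)
  assume neg: "\<not> ?thesis"
  \<comment> \<open>Any summable sequence of bounds would serve here; summability is what
    Borel-Cantelli asks of the measures of the sets \<open>A n\<close>.\<close>
  have "\<exists>A k. A \<in> sets N \<and> measure N A < (1/2) ^ n \<and> \<eta> \<le> measure (L k) A" for n :: nat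
    using neg[unfolded not_ex, rule_format, of "(1/2) ^ n"] by (auto simp: not_less)
  then obtain A k where A: "\<And>n. A n \<in> sets N" "\<And>n. measure N (A n) < (1/2) ^ n"
    and k: "\<And>n. \<eta> \<le> measure (L (k n)) (A n)"
    by metis
  \<comment> \<open>The tail unions decrease to the limsup of \<open>A\<close>, so Borel-Cantelli
    makes their intersection null for \<open>N\<close>. Unlike the \<open>A n\<close>, they are
    nested, which gives continuity from above.\<close>
  define B where "B n = (\<Union>m\<in>{n..}. A m)" for n
  have B: "B n \<in> sets N" for n
    unfolding B_def using A(1) by (intro sets.countable_UN') auto
  have decB: "decseq B"
    unfolding decseq_def B_def by (intro allI impI UN_mono) auto
  have AB: "A m \<subseteq> B n" if "n \<le> m" for m n
    unfolding B_def using that by auto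
  have null: "(\<Inter>n. B n) \<in> null_sets N"
  proof -
    have "summable (\<lambda>n. measure N (A n))"
      by (rule summable_comparison_test'[of "\<lambda>n. (1/2::real) ^ n" 0])
         (use A(2) in \<open>auto simp: less_imp_le summable_geometric\<close>)
    then have "limsup A \<in> null_sets N"
      using A(1) by (intro borel_cantelli_limsup1) (auto simp: N.emeasure_eq_measure)
    then show ?thesis
      by (simp add: limsup_INF_SUP B_def)
  qed
  have L_null: "measure (L j) (\<Inter>n. B n) = 0" for j
    using ac[of j] null by (auto simp: absolutely_continuous_def null_sets_def measure_def)
  have L_B: "(\<lambda>n. measure (L j) (B n)) \<longlonglongrightarrow> 0" for j
    using L.finite_Lim_measure_decseq[of B j] B decB L(2) L_null by (auto simp: image_subset_iff)
  \<comment> \<open>No absolute continuity of the limit measure is assumed: its value on the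
    intersection is the limit of the values of the \<open>L k\<close>, all of them zero.\<close>
  have "measure \<mu> (\<Inter>n. B n) = 0"
    using lim[OF null_setsD2[OF null]] by (simp add: L_null LIMSEQ_const_iff)
  then have \<mu>_B: "(\<lambda>n. measure \<mu> (B n)) \<longlonglongrightarrow> 0"
    using \<mu>.finite_Lim_measure_decseq[of B] B decB \<mu>(2) by (auto simp: image_subset_iff)
  \<comment> \<open>Finitely many of the measures are simultaneously below \<open>\<eta>\<close> on
    a late \<open>B m\<close>. As \<open>A m\<close> lies in \<open>B m\<close>, the offending index
    \<open>k m\<close> is none of these, so the offending indices are unbounded.\<close>
  have k_large: "\<exists>m\<ge>n. K < k m" for n K
  proof -
    have "\<forall>\<^sub>F m in sequentially. \<forall>j\<in>{..K}. measure (L j) (B m) < \<eta>"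
      using order_tendstoD(2)[OF L_B \<open>0 < \<eta>\<close>] by (intro eventually_ball_finite) auto
    with eventually_ge_at_top[of n]
    have "\<forall>\<^sub>F m in sequentially. n \<le> m \<and> (\<forall>j\<in>{..K}. measure (L j) (B m) < \<eta>)"
      by (rule eventually_conj)
    then obtain m where m: "n \<le> m" "\<forall>j\<in>{..K}. measure (L j) (B m) < \<eta>"
      by (auto simp: eventually_sequentially)
    have "\<eta> \<le> measure (L (k m)) (B m)"
      using k[of m] L.finite_measure_mono[of "A m" "B m" "k m"] AB B L(2) by fastforce
    with m(2) have "K < k m"
      by (meson atMost_iff leI not_less)
    with m(1) show ?thesis by auto
  qed
  \<comment> \<open>With \<open>n\<close> fixed, setwise convergence would push all late
    \<open>L j\<close> below \<open>\<eta>\<close> on \<open>B n\<close>. But some late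
    \<open>L (k m)\<close> already has mass at least \<open>\<eta>\<close> on \<open>A m\<close>, a
    subset of \<open>B n\<close>. This lower bound contradicts \<open>\<mu>_B\<close>.\<close>
  have "\<eta> \<le> measure \<mu> (B n)" for n
  proof (rule ccontr)
    assume "\<not> \<eta> \<le> measure \<mu> (B n)"
    then have "\<forall>\<^sub>F j in sequentially. measure (L j) (B n) < \<eta>"
      using order_tendstoD(2)[OF lim[OF B]] by (simp add: not_le)
    then obtain K where K: "\<And>j. K \<le> j \<Longrightarrow> measure (L j) (B n) < \<eta>"
      by (auto simp: eventually_sequentially)
    obtain m where m: "n \<le> m" "K < k m"
      using k_large by blast
    have "measure (L (k m)) (A m) \<le> measure (L (k m)) (B n)"
      using AB[OF m(1)] B L(2) by (intro L.finite_measure_mono) auto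
    with K[of "k m"] k[of m] m(2) show False by simp
  qed
  then have "\<eta> \<le> 0"
    by (intro LIMSEQ_le_const[OF \<mu>_B]) auto
  with \<open>0 < \<eta>\<close> show False by simp
qed

section \<open>Fine partitions for a nonatomic measure\<close>

lemma nonatomic_small_subset:
  assumes "finite_measure N" "nonatomic N" "A \<in> sets N" "0 < measure N A" "0 < \<epsilon>"
  shows "\<exists>B\<in>sets N. B \<subseteq> A \<and> 0 < measure N B \<and> measure N B < \<epsilon>"
proof -
  interpret finite_measure N by fact
  \<comment> \<open>Nonatomicity cuts \<open>B\<close> into \<open>C\<close> and
    \<open>B - C\<close>, both of positive measure; one of the two has at most half the measure of
    \<open>B\<close>.\<close>
  have halve: "\<exists>C\<in>sets N. C \<subseteq> B \<and> 0 < measure N C \<and> measure N C \<le> measure N B / 2"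
    if B: "B \<in> sets N" "0 < measure N B" for B
  proof -
    obtain C where C: "C \<in> sets N" "C \<subseteq> B" "0 < measure N C" "measure N C < measure N B"
      using assms(2)[unfolded nonatomic_def, rule_format, OF B(1)] B(2)
      by (auto simp: emeasure_eq_measure ennreal_less_iff)
    have "measure N (B - C) = measure N B - measure N C"
      using B C by (simp add: finite_measure_Diff)
    with B C show ?thesis
      by (cases "measure N C \<le> measure N B / 2") (auto intro: bexI[of _ C] bexI[of _ "B - C"])
  qed
  have iterate: "\<exists>B\<in>sets N. B \<subseteq> A \<and> 0 < measure N B \<and> measure N B \<le> measure N A / 2 ^ n" for n
  proof (induction n)
    case 0
    then show ?case using assms by auto
  next
    case (Suc n)
    then obtain B where B: "B \<in> sets N" "B \<subseteq> A" "0 < measure N B"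
      "measure N B \<le> measure N A / 2 ^ n" by blast
    with halve[of B] obtain C where "C \<in> sets N" "C \<subseteq> B" "0 < measure N C"
      "measure N C \<le> measure N B / 2" by blast
    with B show ?case
      by (intro bexI[of _ C]) auto
  qed
  obtain n where "measure N A / \<epsilon> < 2 ^ n"
    using real_arch_pow[of 2] by auto
  then have "measure N A / 2 ^ n < \<epsilon>"
    using assms by (simp add: field_simps)
  with iterate[of n] show ?thesis by (meson order_le_less_trans)
qed

text \<open>
  Exhaustion: a countable union of sets with fine covers that has the largest possible measure
  leaves out only a null set.
\<close>

lemma nonatomic_fine_cover:
  assumes N: "finite_measure N" "nonatomic N" and F: "F \<in> sets N" and "0 < \<epsilon>"
  shows "\<exists>D. finite D \<and> D \<subseteq> sets N \<and> \<Union>D = F \<and> (\<forall>I\<in>D. measure N I < \<epsilon>)"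
proof -
  interpret finite_measure N by fact
  define P where "P A \<longleftrightarrow>
    A \<subseteq> F \<and> (\<exists>D. finite D \<and> D \<subseteq> sets N \<and> \<Union>D = A \<and> (\<forall>I\<in>D. measure N I < \<epsilon>))" for A
  have P_empty: "P {}"
    unfolding P_def by (auto intro: exI[of _ "{}"])
  have P_small: "P A" if "A \<in> sets N" "A \<subseteq> F" "measure N A < \<epsilon>" for A
    unfolding P_def using that by (auto intro: exI[of _ "{A}"])
  have P_Un: "P (A \<union> B)" if "P A" "P B" for A B
  proof -
    obtain D where "A \<subseteq> F" "finite D" "D \<subseteq> sets N" "\<Union>D = A" "\<forall>I\<in>D. measure N I < \<epsilon>"
      using \<open>P A\<close> unfolding P_def by blast
    moreover obtain E where "B \<subseteq> F" "finite E" "E \<subseteq> sets N" "\<Union>E = B" "\<forall>I\<in>E. measure N I < \<epsilon>"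
      using \<open>P B\<close> unfolding P_def by blast
    ultimately show ?thesis
      unfolding P_def by (intro conjI exI[of _ "D \<union> E"]) auto
  qed
  have P_UN: "P (\<Union>i\<le>n. A i)" if "\<And>i. P (A i)" for A and n :: nat
    by (induction n) (use that P_Un in \<open>auto simp: atMost_Suc\<close>)
  have P_sets: "A \<in> sets N" if "P A" for A
    using that unfolding P_def by (auto intro: sets.finite_Union)
  define s where "s = (SUP A\<in>Collect P. measure N A)"
  have bdd: "bdd_above (measure N ` Collect P)"
    by (auto intro!: bdd_aboveI[of _ "measure N (space N)"] bounded_measure)
  have le_s: "measure N A \<le> s" if "P A" for A
    unfolding s_def using that bdd by (intro cSUP_upper) auto
  have "\<exists>A. P A \<and> s - 1 / Suc n < measure N A" for n
  proof -
    have "s - 1 / Suc n < s" by simp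
    then show ?thesis
      using less_cSUP_iff[OF _ bdd, of "s - 1 / Suc n"] P_empty unfolding s_def by auto
  qed
  then obtain A where A: "\<And>n. P (A n)" "\<And>n. s - 1 / Suc n < measure N (A n)"
    by metis
  define U where "U n = (\<Union>i\<le>n. A i)" for n
  have U: "P (U n)" for n
    unfolding U_def using A(1) by (rule P_UN)
  have decU: "decseq (\<lambda>n. F - U n)"
    unfolding decseq_def U_def by force
  \<comment> \<open>Otherwise the remainder contains a small set \<open>C\<close> of positive
    measure, disjoint from every \<open>A n\<close>. Adding it to an \<open>A n\<close> within
    \<open>measure N C\<close> of the supremum would exceed \<open>s\<close>.\<close>
  have rest: "measure N (\<Inter>n. F - U n) = 0"
  proof (rule ccontr)
    assume "measure N (\<Inter>n. F - U n) \<noteq> 0"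
    moreover have "(\<Inter>n. F - U n) \<in> sets N"
      using F U P_sets by (intro sets.countable_INT) auto
    ultimately obtain C where C: "C \<in> sets N" "C \<subseteq> (\<Inter>n. F - U n)" "0 < measure N C"
      "measure N C < \<epsilon>"
      using nonatomic_small_subset[OF N] \<open>0 < \<epsilon>\<close> by (metis zero_less_measure_iff)
    obtain n where n: "1 / Suc n < measure N C"
      using reals_Archimedean[OF C(3)] by (auto simp: inverse_eq_divide)
    have "C \<inter> A n = {}"
      using C(2) by (auto simp: U_def)
    then have "measure N (A n \<union> C) = measure N (A n) + measure N C"
      using C(1) A(1) P_sets by (intro finite_measure_Union) auto
    moreover have "P (A n \<union> C)"
      using C by (intro P_Un[OF A(1)] P_small) auto
    ultimately show False
      using le_s[of "A n \<union> C"] A(2)[of n] n by linarith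
  qed
  have "(\<lambda>n. measure N (F - U n)) \<longlonglongrightarrow> 0"
    using finite_Lim_measure_decseq[OF _ decU] F U P_sets rest by (auto simp: image_subset_iff)
  then have "\<forall>\<^sub>F n in sequentially. measure N (F - U n) < \<epsilon>"
    using \<open>0 < \<epsilon>\<close> by (rule order_tendstoD)
  then obtain n where "measure N (F - U n) < \<epsilon>"
    by (auto simp: eventually_sequentially)
  then have "P (U n \<union> (F - U n))"
    using F P_sets[OF U] by (intro P_Un[OF U] P_small) auto
  moreover have "U n \<union> (F - U n) = F"
    using U[of n] unfolding P_def by auto
  ultimately show ?thesis
    unfolding P_def by auto
qed

lemma mesh_less_iff:
  assumes "finite D" "0 < \<delta>"
  shows "mesh N D < \<delta> \<longleftrightarrow> (\<forall>I\<in>D. measure N I < \<delta>)"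
  using assms by (simp add: mesh_def)

text \<open>The sets are added one at a time, each stripped of what is already covered; cells only
  shrink in this way and stay small.\<close>

lemma fin_partition_of_cover:
  assumes N: "finite_measure N" and "finite D" "D \<subseteq> sets N" "\<forall>I\<in>D. measure N I < \<epsilon>"
  shows "\<exists>E\<in>fin_partitions N (\<Union>D). \<forall>I\<in>E. measure N I < \<epsilon>"
  using assms(2-)
proof (induction D rule: finite_induct)
  case empty
  show ?case by (intro bexI[of _ "{}"]) (auto simp: fin_partitions_def partition_on_def)
next
  case (insert A D)
  interpret finite_measure N by fact
  have "\<exists>E\<in>fin_partitions N (\<Union>D). \<forall>I\<in>E. measure N I < \<epsilon>"
    using insert.prems by (intro insert.IH) auto
  then obtain E where E: "finite E" "E \<subseteq> sets N" "partition_on (\<Union>D) E"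
    "\<forall>I\<in>E. measure N I < \<epsilon>"
    by (auto simp: fin_partitions_def)
  show ?case
  \<comment> \<open>If nothing of \<open>A\<close> is left, the stripped set is empty, and
    \<open>partition_on\<close> admits no empty cell.\<close>
  proof (cases "A \<subseteq> \<Union>D")
    case True
    then have "\<Union>(insert A D) = \<Union>D" by auto
    with E show ?thesis by (auto simp: fin_partitions_def)
  next
    case False
    have meas: "A - \<Union>D \<in> sets N"
      using insert by (auto intro: sets.finite_Union)
    have "measure N (A - \<Union>D) \<le> measure N A"
      using insert by (intro finite_measure_mono) auto
    with insert.prems have small: "measure N (A - \<Union>D) < \<epsilon>" by simp
    have "partition_on (\<Union>(insert A D)) (insert (A - \<Union>D) E)"
      using E(3) False unfolding partition_on_def disjoint_def by auto
    with E meas small show ?thesis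
      by (intro bexI[of _ "insert (A - \<Union>D) E"]) (auto simp: fin_partitions_def)
  qed
qed

text \<open>This keeps the limit along fine partitions from being vacuous: if no partition had mesh
  below some bound, every number would be a BC integral.\<close>

lemma NA_plus_fine_partition:
  assumes "N \<in> NA_plus M" "F \<in> sets M" "0 < \<delta>"
  shows "\<exists>D\<in>fin_partitions M F. mesh N D < \<delta>"
proof -
  have N: "sets N = sets M" "finite_measure N" "nonatomic N"
    using assms(1) by (auto simp: NA_plus_def)
  have "F \<in> sets N"
    using N assms(2) by simp
  from nonatomic_fine_cover[OF N(2,3) this \<open>0 < \<delta>\<close>]
  obtain D where D: "finite D" "D \<subseteq> sets N" "\<Union>D = F" "\<forall>I\<in>D. measure N I < \<delta>"
    by blast
  from fin_partition_of_cover[OF N(2) D(1,2,4)]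
  obtain E where "E \<in> fin_partitions N F" "\<forall>I\<in>E. measure N I < \<delta>"
    using D(3) by auto
  with assms N show ?thesis
    by (intro bexI[of _ E]) (auto simp: fin_partitions_def mesh_less_iff)
qed

section \<open>Uniqueness of the integral and sums over fine partitions\<close>

lemma has_BC_integral_unique:
  assumes N: "N \<in> NA_plus M" and F: "F \<in> sets M"
    and l: "has_BC_integral M N \<nu> F l" and l': "has_BC_integral M N \<nu> F l'"
  shows "l = l'"
proof (rule ccontr)
  assume "l \<noteq> l'"
  then have e: "0 < \<bar>l - l'\<bar> / 2" by simp
  obtain d where d: "0 < d" "\<And>D. D \<in> fin_partitions M F \<Longrightarrow> mesh N D < d \<Longrightarrow>
      \<bar>(\<Sum>I\<in>D. \<nu> I) - l\<bar> < \<bar>l - l'\<bar> / 2"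
    using l e unfolding has_BC_integral_def by blast
  obtain d' where d': "0 < d'" "\<And>D. D \<in> fin_partitions M F \<Longrightarrow> mesh N D < d' \<Longrightarrow>
      \<bar>(\<Sum>I\<in>D. \<nu> I) - l'\<bar> < \<bar>l - l'\<bar> / 2"
    using l' e unfolding has_BC_integral_def by blast
  obtain D where "D \<in> fin_partitions M F" "mesh N D < min d d'"
    using NA_plus_fine_partition[OF N F, of "min d d'"] d(1) d'(1) by auto
  with d(2)[of D] d'(2)[of D] show False by (simp add: abs_if split: if_splits)
qed

lemma BC_integral_eq:
  assumes "N \<in> NA_plus M" "F \<in> sets M" "has_BC_integral M N \<nu> F l"
  shows "BC_integral M N \<nu> F = l"
  unfolding BC_integral_def using assms has_BC_integral_unique by (intro the_equality) blast+

text \<open>The error on each cell is proportional to its mass, so the number of cells does not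
  enter, and total mass 1 removes the dependence on \<open>F\<close>.\<close>

lemma partition_sum_estimate:
  fixes f :: "real \<Rightarrow> real"
  assumes N: "prob_space N" "sets N = sets M"
    and D: "D \<in> fin_partitions M F"
    and f: "\<And>x. 0 \<le> x \<Longrightarrow> x < \<eta> \<Longrightarrow> \<bar>f x - c * x\<bar> \<le> \<epsilon> * x"
    and small: "\<And>I. I \<in> D \<Longrightarrow> measure N I < \<eta>" and "0 \<le> \<epsilon>"
  shows "\<bar>(\<Sum>I\<in>D. f (measure N I)) - c * measure N F\<bar> \<le> \<epsilon>"
proof -
  interpret prob_space N by fact
  have D': "finite D" "D \<subseteq> sets N" "\<Union>D = F" "disjoint D"
    using D N(2) by (auto simp: fin_partitions_def partition_on_def)
  have F: "measure N F = (\<Sum>I\<in>D. measure N I)"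
    using finite_measure_finite_Union[of D "\<lambda>I. I"] D'
    by (auto simp: disjoint_def disjoint_family_on_def)
  have "\<bar>(\<Sum>I\<in>D. f (measure N I)) - c * measure N F\<bar> =
      \<bar>\<Sum>I\<in>D. f (measure N I) - c * measure N I\<bar>"
    by (simp add: F sum_subtractf sum_distrib_left)
  also have "\<dots> \<le> (\<Sum>I\<in>D. \<epsilon> * measure N I)"
    by (intro order_trans[OF sum_abs] sum_mono f small) auto
  also have "\<dots> = \<epsilon> * measure N F"
    by (simp add: F sum_distrib_left)
  also have "\<dots> \<le> \<epsilon>"
    using \<open>0 \<le> \<epsilon>\<close> by (intro mult_left_le) auto
  finally show ?thesis .
qed

section \<open>The mixture measure\<close>

lemma finite_measure_mix_measure:
  assumes "\<And>n. prob_space (L n)" and L: "\<And>n. sets (L n) = sets M"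
  shows "finite_measure (mix_measure M L)"
proof
  have "space (L n) = space M" for n
    using L by (rule sets_eq_imp_space_eq)
  then have "emeasure (L n) (space M) = 1" for n
    using prob_space.emeasure_space_1[OF assms(1)[of n]] by simp
  then have "emeasure (mix_measure M L) (space M) = (\<Sum>n. ennreal ((1/2) ^ Suc n))"
    using L by (simp add: emeasure_mix_measure divide_ennreal_def ennreal_inverse_power
      flip: ennreal_power inverse_ennreal divide_ennreal del: power_Suc)
  also have "\<dots> = ennreal 1"
    using power_half_series by (intro suminf_ennreal_eq) auto
  finally show "emeasure (mix_measure M L) (space (mix_measure M L)) \<noteq> \<infinity>"
    by (simp add: mix_measure_def)
qed

text \<open>A single term of the series is bounded by the whole sum, and its weight is
  positive.\<close>

lemma absolutely_continuous_mix_measure: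
  assumes L: "\<And>n. sets (L n) = sets M"
  shows "absolutely_continuous (mix_measure M L) (L k)"
  unfolding absolutely_continuous_def
proof
  fix A assume "A \<in> null_sets (mix_measure M L)"
  then have A: "A \<in> sets M" "(\<Sum>n. emeasure (L n) A / 2 ^ Suc n) = 0"
    using emeasure_mix_measure[OF L] by (auto simp: null_sets_def sets_mix_measure)
  have "emeasure (L k) A / 2 ^ Suc k \<le> (\<Sum>n. emeasure (L n) A / 2 ^ Suc n)"
    using sum_le_suminf[of "\<lambda>n. emeasure (L n) A / 2 ^ Suc n" "{k}"] by (simp del: power_Suc)
  with A L show "A \<in> null_sets (L k)"
    by (simp add: null_sets_def ennreal_divide_eq_0_iff power_eq_top_ennreal del: power_Suc)
qed

section \<open>Uniform integrability of the games\<close>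

theorem proposition4p4:
  fixes M :: "'a measure"
    and f :: "nat \<Rightarrow> real \<Rightarrow> real"
    and f' :: "nat \<Rightarrow> real"
    and L :: "nat \<Rightarrow> 'a measure"
    and \<mu> :: "'a measure"
  assumes "standard_borel_space M"
    and "\<And>k. \<exists>C. C-lipschitz_on {0..1} (f k)"
    and "\<And>k. f k 0 = 0"
    and "\<And>k. L k \<in> NA_plus M"
    and "\<And>k. prob_space (L k)"
    and "\<And>k. (f k has_real_derivative f' k) (at_right 0)"
    and "uniform_limit UNIV (\<lambda>x k. f k x / x) f' (at_right 0)"
    and "\<mu> \<in> NA_plus M"
    and "prob_space \<mu>"
    and "\<And>A. A \<in> sets M \<Longrightarrow> (\<lambda>k. measure (L k) A) \<longlonglongrightarrow> measure \<mu> A"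
  shows "uniformly_BC_integrable M L (\<lambda>k A. f k (measure (L k) A))"
proof -
  have L: "sets (L k) = sets M" "finite_measure (L k)" for k
    using assms(4)[of k] by (auto simp: NA_plus_def)
  have \<mu>: "sets \<mu> = sets M" "finite_measure \<mu>"
    using assms(8) by (auto simp: NA_plus_def)
  \<comment> \<open>Hypothesis (1) multiplied by \<open>x\<close>. The point \<open>x = 0\<close>,
    where the quotient says nothing, is included through \<open>f k 0 = 0\<close>, since cells may
    have measure zero.\<close>
  have near: "\<exists>\<eta>>0. \<forall>k x. 0 \<le> x \<longrightarrow> x < \<eta> \<longrightarrow> \<bar>f k x - f' k * x\<bar> \<le> \<epsilon> * x" if \<epsilon>: "0 < \<epsilon>" for \<epsilon>
  proof -
    have "\<forall>\<^sub>F x in at_right 0. \<forall>k. dist (f k x / x) (f' k) < \<epsilon>"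
      using uniform_limitD[OF assms(7) \<epsilon>] by simp
    then obtain \<eta> where \<eta>: "0 < \<eta>"
      "\<And>x k. 0 < x \<Longrightarrow> x < \<eta> \<Longrightarrow> dist (f k x / x) (f' k) < \<epsilon>"
      by (auto simp: eventually_at_right_field)
    have "\<bar>f k x - f' k * x\<bar> \<le> \<epsilon> * x" if x: "0 < x" "x < \<eta>" for k x
    proof -
      have "\<bar>f k x - f' k * x\<bar> = \<bar>f k x / x - f' k\<bar> * x"
        using x by (simp add: abs_mult_pos divide_simps left_diff_distrib)
      also have "\<dots> \<le> \<epsilon> * x"
        using \<eta>(2)[OF x, of k] x by (intro mult_right_mono) (auto simp: dist_real_def)
      finally show ?thesis .
    qed
    with \<eta>(1) assms(3) show ?thesis
      by (metis abs_zero diff_zero mult_zero_right order_le_less)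
  qed
  \<comment> \<open>The order of quantifiers matters: \<open>\<eta>\<close> is fixed before
    \<open>F\<close>, \<open>D\<close> and \<open>k\<close>. Passing through
    \<open>\<epsilon> / 2\<close> makes the final inequality strict.\<close>
  have estimate: "\<exists>\<eta>>0. \<forall>F. \<forall>D\<in>fin_partitions M F. \<forall>k. (\<forall>I\<in>D. measure (L k) I < \<eta>) \<longrightarrow>
      \<bar>(\<Sum>I\<in>D. f k (measure (L k) I)) - f' k * measure (L k) F\<bar> < \<epsilon>" if \<epsilon>: "0 < \<epsilon>" for \<epsilon>
  proof -
    obtain \<eta> where \<eta>: "0 < \<eta>"
      "\<And>k x. 0 \<le> x \<Longrightarrow> x < \<eta> \<Longrightarrow> \<bar>f k x - f' k * x\<bar> \<le> \<epsilon> / 2 * x"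
      using near[of "\<epsilon> / 2"] \<epsilon> by auto
    have "\<bar>(\<Sum>I\<in>D. f k (measure (L k) I)) - f' k * measure (L k) F\<bar> \<le> \<epsilon> / 2"
      if "D \<in> fin_partitions M F" "\<forall>I\<in>D. measure (L k) I < \<eta>" for F D k
      using that \<epsilon> by (intro partition_sum_estimate[OF assms(5) L(1) _ \<eta>(2)]) auto
    with \<eta>(1) \<epsilon> show ?thesis by fastforce
  qed
  have integral: "has_BC_integral M (L k) (\<lambda>A. f k (measure (L k) A)) F (f' k * measure (L k) F)"
    for k F
    unfolding has_BC_integral_def
  proof (intro allI impI)
    fix \<epsilon> :: real assume "0 < \<epsilon>"
    then obtain \<eta> where "0 < \<eta>" "\<forall>F. \<forall>D\<in>fin_partitions M F. \<forall>k.
        (\<forall>I\<in>D. measure (L k) I < \<eta>) \<longrightarrow>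
        \<bar>(\<Sum>I\<in>D. f k (measure (L k) I)) - f' k * measure (L k) F\<bar> < \<epsilon>"
      using estimate by blast
    \<comment> \<open>The mesh is taken with respect to \<open>L k\<close> itself, so
      \<open>\<eta>\<close> serves directly as the mesh bound.\<close>
    then show "\<exists>\<delta>>0. \<forall>D\<in>fin_partitions M F. mesh (L k) D < \<delta> \<longrightarrow>
        \<bar>(\<Sum>I\<in>D. f k (measure (L k) I)) - f' k * measure (L k) F\<bar> < \<epsilon>"
      by (intro exI[of _ \<eta>]) (auto simp: mesh_less_iff fin_partitions_def)
  qed
  have "BC_integrable M (L k) (\<lambda>A. f k (measure (L k) A))" for k
    using assms(3,4) integral unfolding BC_integrable_def game_def by auto blast
  moreover have "\<exists>\<delta>>0. \<forall>D\<in>fin_partitions M F. mesh (mix_measure M L) D < \<delta> \<longrightarrow>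
        (\<forall>k. \<bar>(\<Sum>I\<in>D. f k (measure (L k) I)) -
          BC_integral M (L k) (\<lambda>A. f k (measure (L k) A)) F\<bar> < \<epsilon>)"
    if F: "F \<in> sets M" and \<epsilon>: "0 < \<epsilon>" for F \<epsilon>
  proof -
    obtain \<eta> where \<eta>: "0 < \<eta>" "\<forall>F. \<forall>D\<in>fin_partitions M F. \<forall>k.
        (\<forall>I\<in>D. measure (L k) I < \<eta>) \<longrightarrow>
        \<bar>(\<Sum>I\<in>D. f k (measure (L k) I)) - f' k * measure (L k) F\<bar> < \<epsilon>"
      using estimate[OF \<epsilon>] by blast
    \<comment> \<open>Now the mesh is that of the mixture. The trivial bound of \<open>L k\<close>
      by \<open>2 ^ Suc k\<close> times the mixture degenerates as \<open>k\<close> grows, hence the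
      appeal to setwise convergence.\<close>
    have "\<exists>\<delta>>0. \<forall>A\<in>sets (mix_measure M L). measure (mix_measure M L) A < \<delta> \<longrightarrow>
        (\<forall>k. measure (L k) A < \<eta>)"
      using L \<mu> assms(5,10) \<eta>(1)
      by (intro vitali_hahn_saks_nonneg[where \<mu> = \<mu>] finite_measure_mix_measure
          absolutely_continuous_mix_measure) (auto simp: sets_mix_measure)
    then obtain \<delta> where \<delta>: "0 < \<delta>"
      "\<And>A k. A \<in> sets M \<Longrightarrow> measure (mix_measure M L) A < \<delta> \<Longrightarrow> measure (L k) A < \<eta>"
      unfolding sets_mix_measure by blast
    have "\<bar>(\<Sum>I\<in>D. f k (measure (L k) I)) -
          BC_integral M (L k) (\<lambda>A. f k (measure (L k) A)) F\<bar> < \<epsilon>"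
      if D: "D \<in> fin_partitions M F" "mesh (mix_measure M L) D < \<delta>" for D k
    proof -
      have "\<forall>I\<in>D. measure (L k) I < \<eta>"
        using D \<delta> by (auto simp: mesh_less_iff fin_partitions_def)
      with \<eta>(2) D(1) show ?thesis
        by (simp add: BC_integral_eq[OF assms(4) F integral])
    qed
    with \<delta>(1) show ?thesis by blast
  qed
  ultimately show ?thesis
    unfolding uniformly_BC_integrable_def by blast
qed

end
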